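(* Let $X$ be a completely regular Hausdorff space with $|X|>1$. Then the zero-set intersection graph $\Gamma(C(X))$ is both triangulated and hypertriangulated.
   Context: $C(X)$ is the ring of all continuous functions $X\to\mathbb{R}$ with pointwise operations. For $f\in C(X)$, $Z(f)=\{x\in X: f(x)=0\}$. $\Gamma(C(X))$ is the simple graph whose vertex set is the set of non-units of $C(X)$ (equivalently, the $f$ with $Z(f)\neq\emptyset$), two distinct vertices $f,g$ being adjacent iff $Z(f)\cap Z(g)\neq\emptyset$. A graph is triangulated if every vertex is a vertex of a triangle (3-cycle), and hypertriangulated if every edge is an edge of a triangle. *)

theory Defs
  imports "HOL-Analysis.Analysis" "HOL-Algebra.Ring"
begin

text \<open>
  The elements of \<open>C(X)\<close> are the continuous functions restricted to the carrier of \<open>X\<close>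
  (\<open>undefined\<close> elsewhere), so that HOL equality of elements is equality of functions on \<open>X\<close>.
\<close>

definition cont_ring :: "'a topology \<Rightarrow> ('a \<Rightarrow> real) ring" where
  "cont_ring X =
     \<lparr>carrier = {f \<in> extensional (topspace X). continuous_map X euclideanreal f},
      mult = (\<lambda>f g. \<lambda>x\<in>topspace X. f x * g x),
      one = (\<lambda>x\<in>topspace X. 1),
      zero = (\<lambda>x\<in>topspace X. 0),
      add = (\<lambda>f g. \<lambda>x\<in>topspace X. f x + g x)\<rparr>"

definition zero_set :: "'a topology \<Rightarrow> ('a \<Rightarrow> real) \<Rightarrow> 'a set" where
  "zero_set X f = {x \<in> topspace X. f x = 0}"

record 'v ugraph =
  uverts :: "'v set"
  uedges :: "'v set set"

definition simple_ugraph :: "'v ugraph \<Rightarrow> bool" where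
  "simple_ugraph G \<longleftrightarrow> (\<forall>e\<in>uedges G. e \<subseteq> uverts G \<and> card e = 2)"

definition is_triangle :: "'v ugraph \<Rightarrow> 'v \<Rightarrow> 'v \<Rightarrow> 'v \<Rightarrow> bool" where
  "is_triangle G u v w \<longleftrightarrow>
     u \<in> uverts G \<and> v \<in> uverts G \<and> w \<in> uverts G \<and>
     u \<noteq> v \<and> v \<noteq> w \<and> u \<noteq> w \<and>
     {u, v} \<in> uedges G \<and> {v, w} \<in> uedges G \<and> {u, w} \<in> uedges G"

definition triangulated :: "'v ugraph \<Rightarrow> bool" where
  "triangulated G \<longleftrightarrow> (\<forall>u\<in>uverts G. \<exists>v w. is_triangle G u v w)"

definition hypertriangulated :: "'v ugraph \<Rightarrow> bool" where
  "hypertriangulated G \<longleftrightarrow> (\<forall>e\<in>uedges G. \<exists>u v w. e = {u, v} \<and> is_triangle G u v w)"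

definition zero_set_graph :: "'a topology \<Rightarrow> ('a \<Rightarrow> real) ugraph" where
  "zero_set_graph X =
     (let V = carrier (cont_ring X) - Units (cont_ring X)
      in \<lparr>uverts = V,
          uedges = {{f, g} | f g. f \<in> V \<and> g \<in> V \<and> f \<noteq> g \<and>
                                   zero_set X f \<inter> zero_set X g \<noteq> {}}\<rparr>)"

lemma carrier_cont_ring:
  "f \<in> carrier (cont_ring X) \<longleftrightarrow>
     f \<in> extensional (topspace X) \<and> continuous_map X euclideanreal f"
  by (simp add: cont_ring_def)

lemma restrict_in_cont_ring:
  assumes "continuous_map X euclideanreal f"
  shows "restrict f (topspace X) \<in> carrier (cont_ring X)"
  using assms by (auto simp: carrier_cont_ring intro: continuous_map_eq)

lemma cring_cont_ring: "cring (cont_ring X)"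
proof (rule cringI)
  show "abelian_group (cont_ring X)"
  proof (rule abelian_groupI)
    fix f assume f: "f \<in> carrier (cont_ring X)"
    show "\<exists>g\<in>carrier (cont_ring X). g \<oplus>\<^bsub>cont_ring X\<^esub> f = \<zero>\<^bsub>cont_ring X\<^esub>"
    proof
      show "(\<lambda>x\<in>topspace X. - f x) \<in> carrier (cont_ring X)"
        using f by (intro restrict_in_cont_ring continuous_map_minus) (simp add: carrier_cont_ring)
    qed (auto simp: cont_ring_def)
  next
    fix f g assume "f \<in> carrier (cont_ring X)" "g \<in> carrier (cont_ring X)"
    then have "(\<lambda>x\<in>topspace X. f x + g x) \<in> carrier (cont_ring X)"
      by (intro restrict_in_cont_ring continuous_map_add) (simp_all add: carrier_cont_ring)
    then show "f \<oplus>\<^bsub>cont_ring X\<^esub> g \<in> carrier (cont_ring X)"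
      by (simp add: cont_ring_def)
  next
    have "(\<lambda>x\<in>topspace X. 0) \<in> carrier (cont_ring X)"
      by (intro restrict_in_cont_ring) simp
    then show "\<zero>\<^bsub>cont_ring X\<^esub> \<in> carrier (cont_ring X)"
      by (simp add: cont_ring_def)
  qed (auto simp: cont_ring_def extensional_def fun_eq_iff)
next
  show "comm_monoid (cont_ring X)"
  proof (rule comm_monoidI)
    fix f g assume "f \<in> carrier (cont_ring X)" "g \<in> carrier (cont_ring X)"
    then have "(\<lambda>x\<in>topspace X. f x * g x) \<in> carrier (cont_ring X)"
      by (intro restrict_in_cont_ring continuous_map_real_mult) (simp_all add: carrier_cont_ring)
    then show "f \<otimes>\<^bsub>cont_ring X\<^esub> g \<in> carrier (cont_ring X)"
      by (simp add: cont_ring_def)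
  next
    have "(\<lambda>x\<in>topspace X. 1) \<in> carrier (cont_ring X)"
      by (intro restrict_in_cont_ring) simp
    then show "\<one>\<^bsub>cont_ring X\<^esub> \<in> carrier (cont_ring X)"
      by (simp add: cont_ring_def)
  qed (auto simp: cont_ring_def extensional_def fun_eq_iff)
qed (auto simp: cont_ring_def fun_eq_iff distrib_right)

lemma nonunit_cont_ring_iff:
  assumes f: "f \<in> carrier (cont_ring X)"
  shows "f \<notin> Units (cont_ring X) \<longleftrightarrow> zero_set X f \<noteq> {}"
proof
  assume "f \<notin> Units (cont_ring X)"
  show "zero_set X f \<noteq> {}"
  proof
    assume "zero_set X f = {}"
    then have nz: "f x \<noteq> 0" if "x \<in> topspace X" for x
      using that by (auto simp: zero_set_def)
    let ?g = "\<lambda>x\<in>topspace X. inverse (f x)"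
    have "?g \<in> carrier (cont_ring X)"
      using f nz by (intro restrict_in_cont_ring continuous_map_real_inverse)
        (auto simp: carrier_cont_ring)
    moreover have "?g \<otimes>\<^bsub>cont_ring X\<^esub> f = \<one>\<^bsub>cont_ring X\<^esub>" "f \<otimes>\<^bsub>cont_ring X\<^esub> ?g = \<one>\<^bsub>cont_ring X\<^esub>"
      using nz by (auto simp: cont_ring_def fun_eq_iff)
    ultimately have "f \<in> Units (cont_ring X)"
      using f by (auto simp: Units_def)
    with \<open>f \<notin> Units (cont_ring X)\<close> show False ..
  qed
next
  assume "zero_set X f \<noteq> {}"
  then obtain x where x: "x \<in> topspace X" "f x = 0"
    by (auto simp: zero_set_def)
  show "f \<notin> Units (cont_ring X)"
  proof
    assume "f \<in> Units (cont_ring X)"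
    then obtain g where "g \<otimes>\<^bsub>cont_ring X\<^esub> f = \<one>\<^bsub>cont_ring X\<^esub>"
      by (auto simp: Units_def)
    then have "(\<lambda>x\<in>topspace X. g x * f x) x = (\<lambda>x\<in>topspace X. 1) x"
      by (simp add: cont_ring_def)
    with x show False by simp
  qed
qed

lemma simple_zero_set_graph: "simple_ugraph (zero_set_graph X)"
  by (auto simp: simple_ugraph_def zero_set_graph_def Let_def)

end

theory Submission
  imports Defs
begin

text \<open>
  The functions vanishing at a point \<open>p\<close> form a clique. Complete regularity and a
  second point give a continuous \<open>h\<close> with \<open>h p = 0\<close> that is not identically zero, and its real
  multiples make this clique infinite. Hence any vertex or edge of it extends to a triangle.
\<close>

lemma infinite_cont_ring_vanishing:
  assumes "completely_regular_space X" "Hausdorff_space X"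
    and p: "p \<in> topspace X" and q: "q \<in> topspace X" and "p \<noteq> q"
  shows "infinite {f \<in> carrier (cont_ring X). p \<in> zero_set X f}"
proof -
  have "closedin X {q}"
    using assms by (simp add: closedin_Hausdorff_singleton)
  then obtain h where cont: "continuous_map X (top_of_set {0..1::real}) h"
    and h: "h p = 0" "h q = 1"
    using assms unfolding completely_regular_space_def
    by (metis DiffI image_subset_iff insertI1 singletonD)
  define m where "m c = (\<lambda>x\<in>topspace X. c * h x)" for c :: real
  have "continuous_map X euclideanreal (\<lambda>x. c * h x)" for c
    using cont by (intro continuous_map_real_mult_left) (simp add: continuous_map_in_subtopology)
  then have "range m \<subseteq> {f \<in> carrier (cont_ring X). p \<in> zero_set X f}"
    using p h by (auto simp: m_def zero_set_def intro: restrict_in_cont_ring)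
  moreover have "m c q = c" for c
    using q h by (simp add: m_def)
  then have "inj m"
    by (metis injI)
  then have "infinite (range m)"
    by (simp add: finite_image_iff infinite_UNIV_char_0)
  ultimately show ?thesis
    using finite_subset by blast
qed

lemma uverts_zero_set_graph:
  "f \<in> uverts (zero_set_graph X) \<longleftrightarrow> f \<in> carrier (cont_ring X) \<and> zero_set X f \<noteq> {}"
  using nonunit_cont_ring_iff[of f X] by (auto simp: zero_set_graph_def Let_def)

lemma uedges_zero_set_graph:
  "uedges (zero_set_graph X) =
     {{f, g} | f g. f \<in> carrier (cont_ring X) \<and> g \<in> carrier (cont_ring X) \<and> f \<noteq> g \<and>
                    zero_set X f \<inter> zero_set X g \<noteq> {}}"
proof -
  have "uedges (zero_set_graph X) =
     {{f, g} | f g. f \<in> uverts (zero_set_graph X) \<and> g \<in> uverts (zero_set_graph X) \<and> f \<noteq> g \<and>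
                    zero_set X f \<inter> zero_set X g \<noteq> {}}"
    by (simp add: zero_set_graph_def Let_def)
  then show ?thesis
    unfolding uverts_zero_set_graph by blast
qed

lemma is_triangle_zero_set_graph:
  assumes "f \<in> carrier (cont_ring X)" "g \<in> carrier (cont_ring X)" "h \<in> carrier (cont_ring X)"
    and "p \<in> zero_set X f" "p \<in> zero_set X g" "p \<in> zero_set X h"
    and "f \<noteq> g" "g \<noteq> h" "f \<noteq> h"
  shows "is_triangle (zero_set_graph X) f g h"
proof -
  have "{u, v} \<in> uedges (zero_set_graph X)"
    if "u \<in> carrier (cont_ring X)" "v \<in> carrier (cont_ring X)" "u \<noteq> v"
      "p \<in> zero_set X u" "p \<in> zero_set X v" for u v
    unfolding uedges_zero_set_graph mem_Collect_eq
    by (rule exI[of _ u], rule exI[of _ v]) (use that in auto)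
  then show ?thesis
    using assms unfolding is_triangle_def uverts_zero_set_graph by auto
qed

theorem theorem3p1:
  fixes X :: "'a topology"
  assumes "completely_regular_space X"
    and "Hausdorff_space X"
    and "\<exists>x\<in>topspace X. \<exists>y\<in>topspace X. x \<noteq> y"
  shows "triangulated (zero_set_graph X) \<and> hypertriangulated (zero_set_graph X)"
proof -
  have fresh: "\<exists>h \<in> carrier (cont_ring X). p \<in> zero_set X h \<and> h \<notin> F"
    if "finite F" "p \<in> topspace X" for F p
  proof -
    obtain q where "q \<in> topspace X" "p \<noteq> q"
      using assms(3) by metis
    then have "infinite {f \<in> carrier (cont_ring X). p \<in> zero_set X f}"
      using infinite_cont_ring_vanishing assms(1,2) that(2) by metis
    then have "\<not> {f \<in> carrier (cont_ring X). p \<in> zero_set X f} \<subseteq> F"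
      using \<open>finite F\<close> finite_subset by metis
    then show ?thesis
      by auto
  qed
  have third: "\<exists>h. is_triangle (zero_set_graph X) f g h"
    if fg: "f \<in> carrier (cont_ring X)" "g \<in> carrier (cont_ring X)" "f \<noteq> g"
      and p: "p \<in> zero_set X f" "p \<in> zero_set X g" for f g p
  proof -
    have "p \<in> topspace X"
      using p by (simp add: zero_set_def)
    then obtain h where "h \<in> carrier (cont_ring X)" "p \<in> zero_set X h" "h \<notin> {f, g}"
      using fresh[of "{f, g}" p] by blast
    then show ?thesis
      using is_triangle_zero_set_graph[of f X g h p] fg p by auto
  qed
  show ?thesis
  proof
    show "triangulated (zero_set_graph X)"
      unfolding triangulated_def
    proof
      fix f assume "f \<in> uverts (zero_set_graph X)"
      then obtain p where f: "f \<in> carrier (cont_ring X)" "p \<in> zero_set X f"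
        unfolding uverts_zero_set_graph by blast
      then have "p \<in> topspace X"
        by (simp add: zero_set_def)
      then obtain g where "g \<in> carrier (cont_ring X)" "p \<in> zero_set X g" "g \<notin> {f}"
        using fresh[of "{f}" p] by blast
      then show "\<exists>g h. is_triangle (zero_set_graph X) f g h"
        using third[of f g p] f by auto
    qed
    show "hypertriangulated (zero_set_graph X)"
      unfolding hypertriangulated_def
    proof
      fix e assume "e \<in> uedges (zero_set_graph X)"
      then obtain f g p where "e = {f, g}" "f \<in> carrier (cont_ring X)" "g \<in> carrier (cont_ring X)"
        "f \<noteq> g" "p \<in> zero_set X f" "p \<in> zero_set X g"
        unfolding uedges_zero_set_graph by auto
      moreover from this obtain h where "is_triangle (zero_set_graph X) f g h"
        using third by metis
      ultimately show "\<exists>f g h. e = {f, g} \<and> is_triangle (zero_set_graph X) f g h"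
        by metis
    qed
  qed
qed

end
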